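(* Let $Y$ be a real random variable whose moment generating function $E[e^{tY}]$ exists for $|t|<r$, for some $r>0$. Then the generating function of the probabilistic Lah-Bell polynomials associated with $Y$ is given by $$\exp\left(x\left(E\left[\left(\frac{1}{1-t}\right)^{Y}\right]-1\right)\right)=\sum_{n=0}^{\infty}B_{n}^{(L,Y)}(x)\frac{t^{n}}{n!},$$ that is, for every real $x$ the identity holds for all $t$ in some neighborhood of $0$.
   Context: The probabilistic Lah numbers $L_Y(n,k)$ ($n\ge k\ge 0$) associated with $Y$ are defined by the power series expansion about $t=0$ $$\frac{1}{k!}\left(E\left[\left(\frac{1}{1-t}\right)^{Y}\right]-1\right)^{k}=\sum_{n=k}^{\infty}L_{Y}(n,k)\frac{t^{n}}{n!},\quad k\ge 0.$$ The probabilistic Lah-Bell polynomials associated with $Y$ are $B_{n}^{(L,Y)}(x)=\sum_{k=0}^{n}L_{Y}(n,k)x^{k}$, $n\ge 0$. *)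

theory Defs
  imports "HOL-Probability.Probability"
begin

definition lah_gen :: "'a measure \<Rightarrow> ('a \<Rightarrow> real) \<Rightarrow> real \<Rightarrow> real"
  where "lah_gen M Y t = (\<integral>\<omega>. (1 / (1 - t)) powr (Y \<omega>) \<partial>M)"

text \<open>
  Near \<open>t = 0\<close> the expectation is that of an integrable function, so the convention that the
  Bochner integral of a non-integrable function is \<open>0\<close> plays no role.
\<close>

lemma lah_gen_integrable:
  fixes Y :: "'a \<Rightarrow> real" and r :: real
  assumes "r > 0"
    and "\<And>t. \<bar>t\<bar> < r \<Longrightarrow> integrable M (\<lambda>\<omega>. exp (t * Y \<omega>))"
  shows "\<forall>\<^sub>F t in nhds 0. integrable M (\<lambda>\<omega>. (1 / (1 - t)) powr (Y \<omega>))"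
proof -
  have "((\<lambda>t::real. \<bar>ln (1 / (1 - t))\<bar>) \<longlongrightarrow> \<bar>ln (1 / (1 - 0))\<bar>) (nhds 0)"
    by (intro tendsto_intros filterlim_ident) auto
  then have "\<forall>\<^sub>F t::real in nhds 0. \<bar>ln (1 / (1 - t))\<bar> < r"
    using assms(1) by (intro order_tendstoD) auto
  moreover have "\<forall>\<^sub>F t::real in nhds 0. t < 1"
    using order_tendstoD(2)[OF filterlim_ident, of "0::real" 1] by simp
  ultimately show ?thesis
  proof eventually_elim
    case (elim t)
    then have "1 / (1 - t) \<noteq> 0" by simp
    then have "(\<lambda>\<omega>. (1 / (1 - t)) powr (Y \<omega>)) = (\<lambda>\<omega>. exp (ln (1 / (1 - t)) * Y \<omega>))"
      by (simp add: powr_def mult.commute)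
    with assms(2)[OF elim(1)] show ?case by simp
  qed
qed

text \<open>
  The number \<open>L\<^sub>Y(n,k)\<close> is \<open>n!\<close> times the \<open>n\<close>-th coefficient of the power series expansion about
  \<open>0\<close> of \<open>(E[(1/(1-t))\<^sup>Y] - 1)\<^sup>k / k!\<close>. Coefficients with \<open>n < k\<close> vanish, since the base is \<open>0\<close> at
  \<open>t = 0\<close>.
\<close>

definition prob_lah :: "'a measure \<Rightarrow> ('a \<Rightarrow> real) \<Rightarrow> nat \<Rightarrow> nat \<Rightarrow> real"
  where "prob_lah M Y n k =
    fact n * fps_nth (THE F. (\<lambda>t. 1 / fact k * (lah_gen M Y t - 1) ^ k) has_fps_expansion F) n"

definition prob_lah_bell :: "'a measure \<Rightarrow> ('a \<Rightarrow> real) \<Rightarrow> nat \<Rightarrow> real \<Rightarrow> real"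
  where "prob_lah_bell M Y n x = (\<Sum>k=0..n. prob_lah M Y n k * x ^ k)"

end

theory Submission
  imports Defs
begin

text \<open>
  The binomial series gives \<open>(1/(1-t))\<^sup>Y\<close> as a power series in \<open>t\<close> whose coefficients are the
  rising factorials of \<open>Y\<close> over \<open>n!\<close>. It is dominated termwise by the same series for \<open>\<bar>Y\<bar>\<close> and
  \<open>\<bar>t\<bar>\<close>, whose sum \<open>exp (c \<bar>Y\<bar>)\<close> with \<open>c = - ln (1 - \<bar>t\<bar>)\<close> is integrable for small \<open>t\<close>, so it may
  be integrated term by term. The expansion of \<open>exp (x (E[(1/(1-t))\<^sup>Y] - 1))\<close> is then a composition
  of power series, and its \<open>n\<close>-th coefficient is \<open>B\<^sub>n(x) / n!\<close> by uniqueness of expansions.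
\<close>

section \<open>Uniqueness and powers of power series expansions\<close>

text \<open>Dividing the zero function by the power \<open>subdegree F\<close> of its argument
  leaves a function that is 0 off the origin and takes the leading coefficient of \<open>F\<close>
  at it. Continuity forces that coefficient to vanish, which happens only for
  \<open>F = 0\<close>.\<close>

lemma has_fps_expansion_zero_iff:
  fixes F :: "'a :: {banach, real_normed_field} fps"
  shows "(\<lambda>_. 0) has_fps_expansion F \<longleftrightarrow> F = 0"
proof
  assume F: "(\<lambda>_. 0) has_fps_expansion F"
  define c where "c = fps_nth F (subdegree F)"
  have "(\<lambda>x. if x = 0 then c else 0) has_fps_expansion fps_shift (subdegree F) F"
    using has_fps_expansion_shift[OF F order_refl c_def] by (simp only: div_0)
  from has_fps_expansion_imp_continuous[OF this, of UNIV]
  have "((\<lambda>x::'a. if x = 0 then c else 0) \<longlongrightarrow> c) (at 0)"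
    by (simp add: continuous_within)
  moreover have "((\<lambda>x::'a. if x = 0 then c else 0) \<longlongrightarrow> 0) (at 0)"
    by (rule tendsto_eventually) (simp add: eventually_at_filter)
  ultimately have "c = 0"
    by (rule tendsto_unique[OF at_neq_bot])
  then show "F = 0"
    by (simp add: c_def)
qed auto

text \<open>This makes the definite description in \<open>prob_lah\<close> meaningful.\<close>

lemma has_fps_expansion_unique:
  fixes F G :: "'a :: {banach, real_normed_field} fps"
  assumes "f has_fps_expansion F" "f has_fps_expansion G"
  shows "F = G"
  using has_fps_expansion_diff[OF assms] by (simp add: has_fps_expansion_zero_iff)

lemma has_fps_expansion_power:
  fixes F :: "'a :: {banach, real_normed_field} fps"
  assumes "f has_fps_expansion F"
  shows "(\<lambda>x. f x ^ k) has_fps_expansion F ^ k"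
  by (induction k) (auto intro: has_fps_expansion_mult assms)

lemma has_fps_expansion_imp_eventually_sums:
  fixes F :: "'a :: {banach, real_normed_field} fps"
  assumes "f has_fps_expansion F"
  shows "\<forall>\<^sub>F t in nhds 0. (\<lambda>n. fps_nth F n * t ^ n) sums f t"
proof -
  have "\<forall>\<^sub>F t in nhds 0. t \<in> eball 0 (fps_conv_radius F)"
    using assms
    by (intro eventually_nhds_in_open) (auto simp: has_fps_expansion_def zero_ereal_def)
  moreover have "\<forall>\<^sub>F t in nhds 0. eval_fps F t = f t"
    using assms by (simp add: has_fps_expansion_def)
  ultimately show ?thesis
  proof eventually_elim
    case (elim t)
    then show ?case
      using sums_eval_fps[of t F] by simp
  qed
qed

section \<open>Composition of power series expansions\<close>

text \<open>The coefficients of a power are polynomials with nonnegative coefficients in those of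
  \<open>G\<close>, so the triangle inequality applies. This provides the majorant for
  compositions.\<close>

lemma norm_fps_power_nth_le:
  fixes G :: "'a :: real_normed_field fps"
  shows "norm (fps_nth (G ^ k) n) \<le> fps_nth (Abs_fps (\<lambda>n. norm (fps_nth G n)) ^ k) n"
proof (induction k arbitrary: n)
  case (Suc k)
  show ?case
    unfolding power_Suc fps_mult_nth
    by (intro sum_norm_le) (auto simp: norm_mult intro!: mult_mono Suc)
qed simp

text \<open>Near 0 the double series with terms
  \<open>fps_nth F k * fps_nth (G ^ k) n * t ^ n\<close> converges absolutely. Summed over
  \<open>n\<close> first it gives \<open>f (g t)\<close>, summed over \<open>k\<close> first the
  series of \<open>F oo G\<close>.\<close>

lemma has_fps_expansion_fps_compose:
  fixes F G :: "'a :: {banach, real_normed_field} fps"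
  assumes f: "f has_fps_expansion F" and g: "g has_fps_expansion G"
    and G0: "fps_nth G 0 = 0"
  shows "(\<lambda>t. f (g t)) has_fps_expansion (F oo G)"
proof (rule has_fps_expansionI)
  \<comment> \<open>A real majorant of \<open>G\<close> with the same radius and constant term 0, so
    that \<open>eval_fps H (norm t)\<close> also tends to 0 with \<open>t\<close>.\<close>
  define H where "H = Abs_fps (\<lambda>n. norm (fps_nth G n))"
  have radius_H: "fps_conv_radius H = fps_conv_radius G"
    by (simp add: fps_conv_radius_def H_def)
  have radius_G: "fps_conv_radius G > 0" and radius_F: "fps_conv_radius F > 0"
    using f g by (auto simp: has_fps_expansion_def)
  \<comment> \<open>Keeping the majorant below \<open>\<rho>\<close> keeps it inside the disc of
    convergence of \<open>F\<close>.\<close>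
  obtain \<rho> where \<rho>: "0 < ereal \<rho>" "ereal \<rho> < fps_conv_radius F"
    using ereal_dense2[OF radius_F] by auto
  \<comment> \<open>An expansion agrees with its function on a full neighbourhood, the point 0
    included.\<close>
  have "g 0 = 0"
    using g G0 by (auto simp: has_fps_expansion_def eval_fps_at_0 dest: eventually_nhds_x_imp_x)
  with has_fps_expansion_imp_continuous[OF g, of UNIV]
  have "(g \<longlongrightarrow> 0) (nhds 0)"
    using tendsto_at_iff_tendsto_nhds[of g 0] by (simp add: continuous_at)
  from filterlim_iff[THEN iffD1, OF this]
  have ev1: "\<forall>\<^sub>F t in nhds 0. (\<lambda>k. fps_nth F k * g t ^ k) sums f (g t)"
    using has_fps_expansion_imp_eventually_sums[OF f] by blast
  have "isCont (eval_fps H) 0"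
    using radius_G by (intro continuous_eval_fps) (auto simp: radius_H zero_ereal_def)
  then have "(eval_fps H \<longlongrightarrow> 0) (nhds 0)"
    using tendsto_at_iff_tendsto_nhds[of "eval_fps H" 0]
    by (simp add: continuous_at eval_fps_at_0 H_def G0)
  moreover have "((\<lambda>t::'a. norm t) \<longlongrightarrow> 0) (nhds 0)"
    using tendsto_norm[OF filterlim_ident, of "0::'a"] by simp
  ultimately have "((\<lambda>t::'a. eval_fps H (norm t)) \<longlongrightarrow> 0) (nhds 0)"
    by (rule filterlim_compose)
  then have ev2: "\<forall>\<^sub>F t::'a in nhds 0. eval_fps H (norm t) < \<rho>"
    using \<rho> by (intro order_tendstoD) (auto simp: zero_ereal_def)
  have ev3: "\<forall>\<^sub>F t in nhds 0. t \<in> eball 0 (fps_conv_radius G)"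
    using radius_G by (intro eventually_nhds_in_open) (auto simp: zero_ereal_def)
  have ev4: "\<forall>\<^sub>F t in nhds 0. eval_fps G t = g t"
    using g by (simp add: has_fps_expansion_def)
  show "\<forall>\<^sub>F t in nhds 0. (\<lambda>n. fps_nth (F oo G) n * t ^ n) sums f (g t)"
    using ev1 ev2 ev3 ev4
  proof eventually_elim
    case (elim t)
    define A where "A = (\<lambda>(k, n). fps_nth F k * (fps_nth (G ^ k) n * t ^ n))"
    have t: "ereal (norm t) < fps_conv_radius G"
      using elim(3) by simp
    have H_sums: "(\<lambda>n. fps_nth (H ^ k) n * norm t ^ n) sums (eval_fps H (norm t) ^ k)" for k
    proof -
      have "ereal (norm (norm t)) < fps_conv_radius (H ^ k)"
        using t fps_conv_radius_power[of H k] by (simp add: radius_H)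
      from sums_eval_fps[OF this] show ?thesis
        using t by (simp add: eval_fps_power radius_H)
    qed
    have G_sums: "(\<lambda>n. fps_nth (G ^ k) n * t ^ n) sums (g t ^ k)" for k
    proof -
      have "ereal (norm t) < fps_conv_radius (G ^ k)"
        using t fps_conv_radius_power[of G k] by simp
      from sums_eval_fps[OF this] show ?thesis
        using t elim(4) by (simp add: eval_fps_power)
    qed
    have G_le: "norm (fps_nth (G ^ k) n * t ^ n) \<le> fps_nth (H ^ k) n * norm t ^ n" for k n
      using norm_fps_power_nth_le[of G k n]
      by (auto simp: norm_mult norm_power H_def intro!: mult_right_mono)
    have H_nonneg: "eval_fps H (norm t) \<ge> 0"
      using sums_le[OF _ sums_zero H_sums[of 1]] by (simp add: H_def)
    have G_summable: "summable (\<lambda>n. norm (fps_nth (G ^ k) n * t ^ n))" for k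
      by (rule summable_comparison_test'[OF sums_summable[OF H_sums[of k]]]) (use G_le in auto)
    have G_suminf_le: "(\<Sum>n. norm (fps_nth (G ^ k) n * t ^ n)) \<le> eval_fps H (norm t) ^ k" for k
      using suminf_le[OF G_le G_summable sums_summable[OF H_sums]] sums_unique[OF H_sums[of k]]
      by simp
    have inner: "((\<lambda>n. A (k, n)) has_sum (fps_nth F k * g t ^ k)) UNIV" for k
      unfolding A_def prod.case
      by (intro has_sum_cmult_right norm_summable_imp_has_sum G_summable G_sums)
    have inner_norm: "((\<lambda>n. norm (A (k, n))) has_sum
        (norm (fps_nth F k) * (\<Sum>n. norm (fps_nth (G ^ k) n * t ^ n)))) UNIV" for k
      unfolding A_def prod.case norm_mult[of "fps_nth F k"]
      by (intro has_sum_cmult_right norm_summable_imp_has_sum)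
         (use G_summable[of k] in \<open>auto intro: summable_sums\<close>)
    \<comment> \<open>Absolute convergence of \<open>F\<close> at the value of the majorant; by
      \<open>G_suminf_le\<close> this series dominates the row sums of the norms of
      \<open>A\<close>.\<close>
    have F_summable: "summable (\<lambda>k. norm (fps_nth F k) * eval_fps H (norm t) ^ k)"
    proof -
      have "ereal (norm (of_real (eval_fps H (norm t)) :: 'a)) < fps_conv_radius F"
        using elim(2) H_nonneg \<rho>(2) by (simp add: less_trans[OF _ \<rho>(2)])
      then have "summable (\<lambda>k. norm (fps_nth F k * of_real (eval_fps H (norm t)) ^ k))"
        unfolding fps_conv_radius_def by (rule abs_summable_in_conv_radius)
      then show ?thesis
        using H_nonneg by (simp add: norm_mult norm_power)
    qed
    have "summable (\<lambda>k. norm (fps_nth F k) * (\<Sum>n. norm (fps_nth (G ^ k) n * t ^ n)))"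
      by (rule summable_comparison_test'[OF F_summable])
         (auto intro!: mult_left_mono G_suminf_le simp: abs_mult suminf_nonneg G_summable)
    then have outer: "(\<lambda>k. norm (fps_nth F k) * (\<Sum>n. norm (fps_nth (G ^ k) n * t ^ n)))
        summable_on UNIV"
      by (intro norm_summable_imp_summable_on) (simp add: abs_mult suminf_nonneg G_summable)
    have "(\<lambda>kn. norm (A kn)) summable_on UNIV \<times> UNIV"
      by (rule summable_on_SigmaI[OF inner_norm outer]) simp
    then have A_summable: "A summable_on UNIV \<times> UNIV"
      by (rule abs_summable_summable)
    then obtain S where S: "(A has_sum S) (UNIV \<times> UNIV)"
      by (auto simp: summable_on_def)
    have "((\<lambda>k. fps_nth F k * g t ^ k) has_sum S) UNIV"
      by (rule has_sum_SigmaD[OF S inner])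
    then have "S = f (g t)"
      using elim(1) has_sum_imp_sums sums_unique2 by blast
    have column: "((\<lambda>k. A (k, n)) has_sum (fps_nth (F oo G) n * t ^ n)) UNIV" for n
    proof (rule has_sum_finite_neutralI[of "{0..n}"])
      \<comment> \<open>With zero constant term, \<open>G ^ k\<close> starts no earlier than degree
        \<open>k\<close>, so each column is a finite sum, the one defining the coefficient of
        \<open>F oo G\<close>.\<close>
      have "fps_nth (G ^ k) n = 0" if "k > n" for k
        using that G0 by (simp add: startsby_zero_power_prefix)
      then show "A (k, n) = 0" if "k \<in> UNIV - {0..n}" for k
        using that by (auto simp: A_def)
      show "fps_nth (F oo G) n * t ^ n = (\<Sum>k\<in>{0..n}. A (k, n))"
        by (simp add: A_def fps_compose_nth sum_distrib_right mult.assoc)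
    qed auto
    have "((\<lambda>(n, k). A (k, n)) has_sum S) (UNIV \<times> UNIV)"
      using S by (subst (asm) has_sum_swap)
    from has_sum_SigmaD[OF this, of "\<lambda>n. fps_nth (F oo G) n * t ^ n"] column
    have "((\<lambda>n. fps_nth (F oo G) n * t ^ n) has_sum S) UNIV"
      by simp
    then show ?case
      using has_sum_imp_sums \<open>S = f (g t)\<close> by blast
  qed
qed

section \<open>Power series of the expectation\<close>

text \<open>Binomial series of \<open>1 - t\<close> with exponent \<open>- y\<close>: the sign in
  \<open>- y gchoose n\<close> cancels that of \<open>(- t) ^ n\<close>.\<close>

lemma pochhammer_series_sums:
  fixes y t :: real
  assumes "\<bar>t\<bar> < 1"
  shows "(\<lambda>n. pochhammer y n / fact n * t ^ n) sums ((1 / (1 - t)) powr y)"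
proof -
  have "(\<lambda>n. (- y gchoose n) * (- t) ^ n) sums (1 + - t) powr (- y)"
    using assms by (intro gen_binomial_real) simp
  moreover have "(- y gchoose n) * (- t) ^ n = pochhammer y n / fact n * t ^ n" for n
  proof -
    have "(- 1) ^ n * (- t) ^ n = t ^ n"
      by (simp flip: power_mult_distrib)
    then show ?thesis
      by (simp add: gbinomial_pochhammer mult_ac)
  qed
  moreover have "(1 + - t) powr (- y) = (1 / (1 - t)) powr y"
    using assms by (simp add: powr_minus powr_divide inverse_eq_divide)
  ultimately show ?thesis
    by simp
qed

text \<open>Factor by factor, \<open>\<bar>y + i\<bar> \<le> \<bar>y\<bar> + i\<close>.\<close>

lemma abs_pochhammer_le:
  fixes y :: real
  shows "\<bar>pochhammer y n\<bar> \<le> pochhammer \<bar>y\<bar> n"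
proof (induction n)
  case (Suc n)
  then show ?case
    unfolding pochhammer_Suc abs_mult by (intro mult_mono) auto
qed simp

text \<open>The integrand equals one of \<open>exp (c * Y \<omega>)\<close> and
  \<open>exp (- c * Y \<omega>)\<close>, hence is at most their sum.\<close>

lemma integrable_exp_abs:
  fixes Y :: "'a \<Rightarrow> real"
  assumes Y[measurable]: "Y \<in> borel_measurable M"
    and "integrable M (\<lambda>\<omega>. exp (c * Y \<omega>))" "integrable M (\<lambda>\<omega>. exp (- c * Y \<omega>))"
  shows "integrable M (\<lambda>\<omega>. exp (c * \<bar>Y \<omega>\<bar>))"
proof (rule Bochner_Integration.integrable_bound)
  show "integrable M (\<lambda>\<omega>. exp (c * Y \<omega>) + exp (- c * Y \<omega>))"
    using assms by (intro Bochner_Integration.integrable_add)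
  have "exp (c * \<bar>y\<bar>) \<le> \<bar>exp (c * y) + exp (- c * y)\<bar>" for y
    by (cases "y \<ge> 0") (simp_all add: abs_of_nonneg[OF add_nonneg_nonneg])
  then show "AE \<omega> in M. norm (exp (c * \<bar>Y \<omega>\<bar>)) \<le> norm (exp (c * Y \<omega>) + exp (- c * Y \<omega>))"
    by simp
qed simp

lemma lah_gen_sums:
  fixes Y :: "'a \<Rightarrow> real" and t :: real
  assumes Y[measurable]: "Y \<in> borel_measurable M"
    and t: "\<bar>t\<bar> < 1"
    and int: "integrable M (\<lambda>\<omega>. (1 / (1 - \<bar>t\<bar>)) powr \<bar>Y \<omega>\<bar>)"
  shows "(\<lambda>n. (\<integral>\<omega>. pochhammer (Y \<omega>) n \<partial>M) / fact n * t ^ n) sums lah_gen M Y t"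
proof -
  define a where "a n \<omega> = pochhammer (Y \<omega>) n / fact n * t ^ n" for n \<omega>
  define b where "b n \<omega> = pochhammer \<bar>Y \<omega>\<bar> n / fact n * \<bar>t\<bar> ^ n" for n \<omega>
  have [measurable]: "(\<lambda>\<omega>. pochhammer (Y \<omega>) n) \<in> borel_measurable M" for n
    by (simp add: pochhammer_prod)
  have [measurable]: "a n \<in> borel_measurable M" for n
    unfolding a_def by measurable
  have b_nonneg: "b n \<omega> \<ge> 0" for n \<omega>
    using order_trans[OF abs_ge_zero abs_pochhammer_le[of "Y \<omega>" n]] by (simp add: b_def)
  have b_sums: "(\<lambda>n. b n \<omega>) sums ((1 / (1 - \<bar>t\<bar>)) powr \<bar>Y \<omega>\<bar>)" for \<omega>
    unfolding b_def using t by (intro pochhammer_series_sums) simp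
  have a_le: "\<bar>a n \<omega>\<bar> \<le> b n \<omega>" for n \<omega>
    by (auto simp: a_def b_def abs_mult power_abs abs_pochhammer_le
        intro!: mult_right_mono divide_right_mono)
  have partial_le: "(\<Sum>n<N. \<bar>a n \<omega>\<bar>) \<le> (1 / (1 - \<bar>t\<bar>)) powr \<bar>Y \<omega>\<bar>" for N \<omega>
  proof -
    have "(\<Sum>n<N. \<bar>a n \<omega>\<bar>) \<le> (\<Sum>n<N. b n \<omega>)"
      by (intro sum_mono a_le)
    also have "\<dots> \<le> (1 / (1 - \<bar>t\<bar>)) powr \<bar>Y \<omega>\<bar>"
      using sum_le_suminf[OF sums_summable[OF b_sums]] b_nonneg sums_unique[OF b_sums] by simp
    finally show ?thesis .
  qed
  have a_int: "integrable M (a n)" for n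
  proof (rule Bochner_Integration.integrable_bound[OF int])
    \<comment> \<open>The summation index shadows the outer \<open>n\<close>, which occurs only in
      the bound \<open>Suc n\<close>; the left side is the last term of the sum.\<close>
    have "\<bar>a n \<omega>\<bar> \<le> (\<Sum>n<Suc n. \<bar>a n \<omega>\<bar>)" for \<omega>
      by (simp add: sum_nonneg)
    then have "\<bar>a n \<omega>\<bar> \<le> (1 / (1 - \<bar>t\<bar>)) powr \<bar>Y \<omega>\<bar>" for \<omega>
      using partial_le order_trans by blast
    then show "AE \<omega> in M. norm (a n \<omega>) \<le> norm ((1 / (1 - \<bar>t\<bar>)) powr \<bar>Y \<omega>\<bar>)"
      by simp
  qed simp
  have "(\<lambda>n. integral\<^sup>L M (a n)) sums (\<integral>\<omega>. (\<Sum>n. a n \<omega>) \<partial>M)"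
  proof (rule sums_integral[OF a_int])
    have "summable (\<lambda>n. \<bar>a n \<omega>\<bar>)" for \<omega>
      by (rule summable_comparison_test'[OF sums_summable[OF b_sums[of \<omega>]]]) (simp add: a_le)
    then show "AE \<omega> in M. summable (\<lambda>n. norm (a n \<omega>))"
      by simp
    \<comment> \<open>The integral of the dominating function bounds all partial sums.\<close>
    show "summable (\<lambda>n. \<integral>\<omega>. norm (a n \<omega>) \<partial>M)"
    proof (rule summableI_nonneg_bounded)
      fix N
      have "(\<Sum>n<N. \<integral>\<omega>. norm (a n \<omega>) \<partial>M) = (\<integral>\<omega>. (\<Sum>n<N. norm (a n \<omega>)) \<partial>M)"
        by (intro Bochner_Integration.integral_sum[symmetric] integrable_norm a_int)
      also have "\<dots> \<le> (\<integral>\<omega>. (1 / (1 - \<bar>t\<bar>)) powr \<bar>Y \<omega>\<bar> \<partial>M)"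
        using partial_le
        by (intro integral_mono Bochner_Integration.integrable_sum integrable_norm a_int int) auto
      finally show "(\<Sum>n<N. \<integral>\<omega>. norm (a n \<omega>) \<partial>M) \<le> (\<integral>\<omega>. (1 / (1 - \<bar>t\<bar>)) powr \<bar>Y \<omega>\<bar> \<partial>M)" .
    qed simp
  qed
  moreover have "(\<Sum>n. a n \<omega>) = (1 / (1 - t)) powr Y \<omega>" for \<omega>
    unfolding a_def using sums_unique[OF pochhammer_series_sums[OF t]] by simp
  moreover have "integral\<^sup>L M (a n) = (\<integral>\<omega>. pochhammer (Y \<omega>) n \<partial>M) / fact n * t ^ n" for n
    by (simp add: a_def[abs_def])
  ultimately show ?thesis
    by (simp add: lah_gen_def)
qed

lemma lah_gen_has_fps_expansion:
  fixes Y :: "'a \<Rightarrow> real" and r :: real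
  assumes Y[measurable]: "Y \<in> borel_measurable M"
    and "r > 0"
    and int: "\<And>t. \<bar>t\<bar> < r \<Longrightarrow> integrable M (\<lambda>\<omega>. exp (t * Y \<omega>))"
  shows "lah_gen M Y has_fps_expansion Abs_fps (\<lambda>n. (\<integral>\<omega>. pochhammer (Y \<omega>) n \<partial>M) / fact n)"
proof (rule has_fps_expansionI)
  \<comment> \<open>The exponent \<open>c\<close> below tends to 0 with \<open>t\<close>, so both
    \<open>c\<close> and \<open>- c\<close> end up where the moment generating function
    exists.\<close>
  have "((\<lambda>t::real. \<bar>ln (1 / (1 - \<bar>t\<bar>))\<bar>) \<longlongrightarrow> \<bar>ln (1 / (1 - \<bar>0\<bar>))\<bar>) (nhds 0)"
    by (intro tendsto_intros filterlim_ident) auto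
  then have "\<forall>\<^sub>F t::real in nhds 0. \<bar>ln (1 / (1 - \<bar>t\<bar>))\<bar> < r"
    using \<open>r > 0\<close> by (intro order_tendstoD) auto
  moreover have "\<forall>\<^sub>F t::real in nhds 0. t \<in> {-1<..<1}"
    by (intro eventually_nhds_in_open) auto
  ultimately show "\<forall>\<^sub>F t in nhds 0.
      (\<lambda>n. fps_nth (Abs_fps (\<lambda>n. (\<integral>\<omega>. pochhammer (Y \<omega>) n \<partial>M) / fact n)) n * t ^ n) sums lah_gen M Y t"
  proof eventually_elim
    case (elim t)
    define c where "c = ln (1 / (1 - \<bar>t\<bar>))"
    have t: "\<bar>t\<bar> < 1"
      using elim(2) by auto
    have "integrable M (\<lambda>\<omega>. exp (c * \<bar>Y \<omega>\<bar>))"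
      using elim(1) by (intro integrable_exp_abs int Y) (auto simp: c_def)
    moreover have "(1 / (1 - \<bar>t\<bar>)) powr \<bar>Y \<omega>\<bar> = exp (c * \<bar>Y \<omega>\<bar>)" for \<omega>
      using t by (simp add: powr_def c_def mult.commute)
    ultimately show ?case
      using lah_gen_sums[OF Y t] by simp
  qed
qed

section \<open>Generating function of the Lah-Bell polynomials\<close>

lemma prob_lah_eq:
  assumes "lah_gen M Y has_fps_expansion C"
  shows "prob_lah M Y n k = fact n * (fps_nth ((C - 1) ^ k) n / fact k)"
proof -
  have "(\<lambda>t. 1 / fact k * (lah_gen M Y t - 1) ^ k) has_fps_expansion
      fps_const (1 / fact k) * (C - 1) ^ k"
    by (intro has_fps_expansion_cmult_left has_fps_expansion_power has_fps_expansion_diff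
        has_fps_expansion_1 assms)
  then have "(THE F. (\<lambda>t. 1 / fact k * (lah_gen M Y t - 1) ^ k) has_fps_expansion F) =
      fps_const (1 / fact k) * (C - 1) ^ k"
    by (intro the_equality) (auto intro: has_fps_expansion_unique)
  then show ?thesis
    by (simp add: prob_lah_def)
qed

theorem theorem2p3:
  fixes M :: "'a measure" and Y :: "'a \<Rightarrow> real" and r x :: real
  assumes "prob_space M"
    and "Y \<in> borel_measurable M"
    and "r > 0"
    and "\<And>t. \<bar>t\<bar> < r \<Longrightarrow> integrable M (\<lambda>\<omega>. exp (t * Y \<omega>))"
  shows "\<forall>\<^sub>F t in nhds 0.
    (\<lambda>n. prob_lah_bell M Y n x * t ^ n / fact n) sums exp (x * (lah_gen M Y t - 1))"
proof -
  interpret prob_space M by fact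
  define C where "C = Abs_fps (\<lambda>n. (\<integral>\<omega>. pochhammer (Y \<omega>) n \<partial>M) / fact n)"
  have C: "lah_gen M Y has_fps_expansion C"
    unfolding C_def using assms(2-4) by (rule lah_gen_has_fps_expansion)
  \<comment> \<open>The constant term of \<open>C\<close> is the total mass of \<open>M\<close>,
    which is 1; composition requires this.\<close>
  have "fps_nth (C - 1) 0 = 0"
    by (simp add: C_def prob_space)
  then have "(\<lambda>t. exp (x * (lah_gen M Y t - 1))) has_fps_expansion (fps_exp x oo (C - 1))"
    by (intro has_fps_expansion_fps_compose has_fps_expansion_exp has_fps_expansion_diff
        has_fps_expansion_1 C)
  \<comment> \<open>The coefficient \<open>x ^ k / fact k\<close> of \<open>fps_exp x\<close>
    supplies both the power of \<open>x\<close> and the factor \<open>1 / fact k\<close> of the Lah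
    numbers.\<close>
  moreover have "fps_nth (fps_exp x oo (C - 1)) n = prob_lah_bell M Y n x / fact n" for n
    by (simp add: prob_lah_bell_def prob_lah_eq[OF C] fps_compose_nth sum_divide_distrib mult_ac)
  ultimately show ?thesis
    using has_fps_expansion_imp_eventually_sums by fastforce
qed

end
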